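(* Let $(X,\Sigma,\mu)$ be a complete, $\sigma$-finite measure space and $\ell$ a von Neumann lifting of $\mu$. Let $\mathbb B$ be a Banach space and $\mathbf E$ a Banach $\mathbb B$-bundle over $(X,\Sigma)$. Let $p\in[1,\infty]$ and $v\in\Gamma_p(\mu;\mathbf E)$. Then $\mu$-a.e. $x\in\hat X$ is a Lebesgue point of $v$, meaning that the $\mathcal I^\ell$-limit $$\hat v(x):=\lim_{I\Rightarrow x}\frac{1}{\mu(I)}\int_I v\,d\mu$$ exists (in the norm topology of $\mathbb B$) and belongs to $\mathbf E(x)$. Moreover, setting $\hat v(x):=0$ for every $x\in X$ that is not a Lebesgue point of $v$, the resulting map $\hat v\colon X\to\mathbb B$ belongs to $\bar\Gamma_p(\mu;\mathbf E)$ and satisfies $\pi_\mu(\hat v)=v$.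
   Context: Von Neumann lifting: for a measure space $(X,\Sigma,\mu)$ with $\mu\neq 0$, a map $\ell\colon\Sigma\to\Sigma$ is a von Neumann lifting of $\mu$ if (i) $\ell(\varnothing)=\varnothing$, $\ell(X)=X$, $\ell(E\cap F)=\ell(E)\cap\ell(F)$ and $\ell(E\cup F)=\ell(E)\cup\ell(F)$ for all $E,F\in\Sigma$; (ii) $\ell(E)=\ell(F)$ whenever $\mu(E\Delta F)=0$; (iii) $\mu(E\Delta\ell(E))=0$ for every $E\in\Sigma$. Induced differentiation basis: $\mathcal I^\ell:=\{\ell(E): E\in\Sigma,\ 0<\mu(E)<+\infty\}$. For $x\in X$, $\mathcal I^\ell_x:=\{I\in\mathcal I^\ell: x\in I\}$, and $\hat X:=\{x\in X:\mathcal I^\ell_x\neq\varnothing\}$ (a set of full $\mu$-measure). For $x\in\hat X$ and $I\in\mathcal I^\ell_x$, $\mathcal U^\ell_x(I):=\{J\in\mathcal I^\ell_x: J\subset I\}$. For $x\in\hat X$ and a map $\Phi$ from $\mathcal I^\ell$ to a Hausdorff space, $\lim_{I\Rightarrow x}\Phi(I)=z$ means: for every open neighbourhood $U$ of $z$ there is $I\in\mathcal I^\ell_x$ such that $\Phi(J)\in U$ for every $J\in\mathcal U^\ell_x(I)$. A map $v\colon X\to\mathbb B$ is strongly measurable if it is $\mu$-measurable and it is the $\mu$-a.e. norm limit of a sequence of $\mathbb B$-simple maps $\sum_{i=1}^n\mathbf 1_{E_i}v_i$ ($E_i\in\Sigma$ pairwise disjoint, $\mu(E_i)<\infty$, $v_i\in\mathbb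 B$). $\mathcal L^p(\mu;\mathbb B)$ is the space of strongly measurable $v\colon X\to\mathbb B$ such that $\|v(\cdot)\|_{\mathbb B}$ is $p$-integrable if $p<\infty$, respectively bounded on $X$ if $p=\infty$. $L^p(\mu;\mathbb B)$ is its quotient up to $\mu$-a.e. equality and $\pi_\mu$ the quotient map. Integrals of $\mathbb B$-valued maps are Bochner integrals; they do not depend on the representative of $v$. A Banach $\mathbb B$-bundle over $(X,\Sigma)$ is a multivalued map $\mathbf E$ assigning to every $x\in X$ a closed linear subspace $\mathbf E(x)$ of $\mathbb B$, which is weakly measurable: $\{x\in X:\mathbf E(x)\cap U\neq\varnothing\}\in\Sigma$ for every open $U\subset\mathbb B$. $\bar\Gamma_p(\mu;\mathbf E)$ is the set of $v\in\mathcal L^p(\mu;\mathbb B)$ with $v(x)\in\mathbf E(x)$ for every $x\in X$, and $\Gamma_p(\mu;\mathbf E):=\pi_\mu(\bar\Gamma_p(\mu;\mathbf E))\subset L^p(\mu;\mathbb B)$. *)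

theory Defs
  imports "HOL-Analysis.Analysis"
begin

section \<open>Von Neumann liftings and the induced differentiation basis\<close>

definition von_neumann_lifting :: "'a measure \<Rightarrow> ('a set \<Rightarrow> 'a set) \<Rightarrow> bool" where
  "von_neumann_lifting M l \<longleftrightarrow>
     emeasure M (space M) \<noteq> 0 \<and>
     (\<forall>E\<in>sets M. l E \<in> sets M) \<and>
     l {} = {} \<and> l (space M) = space M \<and>
     (\<forall>E\<in>sets M. \<forall>F\<in>sets M. l (E \<inter> F) = l E \<inter> l F \<and> l (E \<union> F) = l E \<union> l F) \<and>
     (\<forall>E\<in>sets M. \<forall>F\<in>sets M. emeasure M (sym_diff E F) = 0 \<longrightarrow> l E = l F) \<and>
     (\<forall>E\<in>sets M. emeasure M (sym_diff E (l E)) = 0)"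

definition lifting_basis :: "'a measure \<Rightarrow> ('a set \<Rightarrow> 'a set) \<Rightarrow> 'a set set" where
  "lifting_basis M l = {l E | E. E \<in> sets M \<and> 0 < emeasure M E \<and> emeasure M E < \<infinity>}"

definition basis_at :: "'a measure \<Rightarrow> ('a set \<Rightarrow> 'a set) \<Rightarrow> 'a \<Rightarrow> 'a set set" where
  "basis_at M l x = {I \<in> lifting_basis M l. x \<in> I}"

definition basis_domain :: "'a measure \<Rightarrow> ('a set \<Rightarrow> 'a set) \<Rightarrow> 'a set" where
  "basis_domain M l = {x \<in> space M. basis_at M l x \<noteq> {}}"

definition basis_nhd :: "'a measure \<Rightarrow> ('a set \<Rightarrow> 'a set) \<Rightarrow> 'a \<Rightarrow> 'a set \<Rightarrow> 'a set set" where
  "basis_nhd M l x I = {J \<in> basis_at M l x. J \<subseteq> I}"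

definition has_basis_limit ::
  "'a measure \<Rightarrow> ('a set \<Rightarrow> 'a set) \<Rightarrow> 'a \<Rightarrow> ('a set \<Rightarrow> 'c::t2_space) \<Rightarrow> 'c \<Rightarrow> bool" where
  "has_basis_limit M l x \<Phi> z \<longleftrightarrow>
     (\<forall>U. open U \<and> z \<in> U \<longrightarrow> (\<exists>I\<in>basis_at M l x. \<forall>J\<in>basis_nhd M l x I. \<Phi> J \<in> U))"

section \<open>Strong measurability and the Bochner integral\<close>

text \<open>The maps satisfying \<^const>\<open>Bochner_Integration.simple_bochner_integrable\<close> are, on
  \<open>space M\<close>, the finite sums of terms \<open>indicator (E i) x *\<^sub>R v i\<close> with pairwise disjoint
  measurable sets \<open>E i\<close> of finite measure.\<close>

definition strongly_measurable :: "'a measure \<Rightarrow> ('a \<Rightarrow> 'b::banach) \<Rightarrow> bool" where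
  "strongly_measurable M f \<longleftrightarrow>
     f \<in> borel_measurable M \<and>
     (\<exists>s. (\<forall>n. Bochner_Integration.simple_bochner_integrable M (s n)) \<and>
          (AE x in M. (\<lambda>n. s n x) \<longlonglongrightarrow> f x))"

text \<open>The library's Bochner integral is restricted to second countable (that is, separable) spaces.
  The definitions below are the same, with strong measurability in place of Borel measurability,
  and make sense in every Banach space.\<close>

definition has_banach_integral :: "'a measure \<Rightarrow> ('a \<Rightarrow> 'b::banach) \<Rightarrow> 'b \<Rightarrow> bool" where
  "has_banach_integral M f z \<longleftrightarrow>
     strongly_measurable M f \<and>
     (\<exists>s. (\<forall>n. Bochner_Integration.simple_bochner_integrable M (s n)) \<and>
          (\<lambda>n. \<integral>\<^sup>+x. ennreal (norm (f x - s n x)) \<partial>M) \<longlonglongrightarrow> 0 \<and>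
          (\<lambda>n. Bochner_Integration.simple_bochner_integral M (s n)) \<longlonglongrightarrow> z)"

definition banach_integral :: "'a measure \<Rightarrow> ('a \<Rightarrow> 'b::banach) \<Rightarrow> 'b" where
  "banach_integral M f =
     (if \<exists>z. has_banach_integral M f z then THE z. has_banach_integral M f z else 0)"

section \<open>Lebesgue--Bochner spaces and sections of Banach bundles\<close>

definition Lp_maps :: "'a measure \<Rightarrow> ennreal \<Rightarrow> ('a \<Rightarrow> 'b::banach) set" where
  "Lp_maps M p = {v. strongly_measurable M v \<and>
     (if p = \<infinity> then bounded (v ` space M)
      else integrable M (\<lambda>x. norm (v x) powr enn2real p))}"

text \<open>The quotient map: elements of the quotient space are equivalence classes, as sets of maps.\<close>

definition Lp_class :: "'a measure \<Rightarrow> ennreal \<Rightarrow> ('a \<Rightarrow> 'b::banach) \<Rightarrow> ('a \<Rightarrow> 'b) set" where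
  "Lp_class M p v = {w \<in> Lp_maps M p. AE x in M. w x = v x}"

definition banach_bundle :: "'a measure \<Rightarrow> ('a \<Rightarrow> 'b::banach set) \<Rightarrow> bool" where
  "banach_bundle M E \<longleftrightarrow>
     (\<forall>x\<in>space M. subspace (E x) \<and> closed (E x)) \<and>
     (\<forall>U. open U \<longrightarrow> {x \<in> space M. E x \<inter> U \<noteq> {}} \<in> sets M)"

definition section_maps ::
  "'a measure \<Rightarrow> ennreal \<Rightarrow> ('a \<Rightarrow> 'b::banach set) \<Rightarrow> ('a \<Rightarrow> 'b) set" where
  "section_maps M p E = {v \<in> Lp_maps M p. \<forall>x\<in>space M. v x \<in> E x}"

definition section_classes ::
  "'a measure \<Rightarrow> ennreal \<Rightarrow> ('a \<Rightarrow> 'b::banach set) \<Rightarrow> ('a \<Rightarrow> 'b) set set" where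
  "section_classes M p E = Lp_class M p ` section_maps M p E"

section \<open>Lebesgue points\<close>

text \<open>The average of an equivalence class is computed with an arbitrarily chosen representative;
  the integral does not depend on the choice.\<close>

definition class_average :: "'a measure \<Rightarrow> ('a \<Rightarrow> 'b::banach) set \<Rightarrow> 'a set \<Rightarrow> 'b" where
  "class_average M V I =
     (1 / measure M I) *\<^sub>R banach_integral M (\<lambda>x. indicator I x *\<^sub>R (SOME w. w \<in> V) x)"

text \<open>Being a Lebesgue point includes that the limit belongs to the fibre.\<close>

definition lebesgue_point ::
  "'a measure \<Rightarrow> ('a set \<Rightarrow> 'a set) \<Rightarrow> ('a \<Rightarrow> 'b::banach set) \<Rightarrow> ('a \<Rightarrow> 'b) set \<Rightarrow> 'a \<Rightarrow> bool" where
  "lebesgue_point M l E V x \<longleftrightarrow>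
     x \<in> basis_domain M l \<and> (\<exists>z. has_basis_limit M l x (class_average M V) z \<and> z \<in> E x)"

definition precise_rep ::
  "'a measure \<Rightarrow> ('a set \<Rightarrow> 'a set) \<Rightarrow> ('a \<Rightarrow> 'b::banach set) \<Rightarrow> ('a \<Rightarrow> 'b) set \<Rightarrow> 'a \<Rightarrow> 'b" where
  "precise_rep M l E V x =
     (if lebesgue_point M l E V x
      then THE z. has_basis_limit M l x (class_average M V) z else 0)"

end

theory Submission
  imports Defs
begin

text \<open>Since the range of a strongly measurable map \<open>w\<close> is essentially separable, almost every
  point lies, for each \<open>e > 0\<close>, in one of countably many sets \<open>A\<close> of finite measure on which
  \<open>w\<close> is \<open>e\<close>-close to a constant, and \<open>A\<close> and \<open>l A\<close> agree up to a null set. Hence almost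
  every \<open>x \<in> A\<close> lies in \<open>l A\<close>, and the average of \<open>w\<close> over any \<open>J \<subseteq> l A\<close> is
  \<open>2e\<close>-close to \<open>w x\<close>: no covering argument is needed.\<close>

section \<open>Integration in arbitrary Banach spaces\<close>

lemma simple_bochner_integrable_simple:
  "Bochner_Integration.simple_bochner_integrable M s \<Longrightarrow> simple_function M s"
  by (auto elim: Bochner_Integration.simple_bochner_integrable.cases)

text \<open>On each level set of the simple map \<open>s\<close> the function is
  \<open>norm (f x - c)\<close> with \<open>c\<close> fixed, hence a continuous function of
  \<open>f x\<close>. The finitely many pieces are glued along the values of \<open>s\<close>, which
  works in nonseparable spaces too.\<close>

lemma borel_measurable_norm_diff_simple:
  fixes f s :: "'a \<Rightarrow> 'b::real_normed_vector"
  assumes f: "f \<in> borel_measurable M" and s: "simple_function M s"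
  shows "(\<lambda>x. norm (f x - s x)) \<in> borel_measurable M"
proof (rule measurable_compose_countable'[where f = "\<lambda>c x. norm (f x - c)" and I = "s ` space M"])
  fix c
  have "(\<lambda>y::'b. norm (y - c)) \<in> borel_measurable borel"
    by (intro borel_measurable_continuous_onI continuous_intros)
  from measurable_compose[OF f this] show "(\<lambda>x. norm (f x - c)) \<in> borel_measurable M" .
next
  show "s \<in> measurable M (count_space (s ` space M))"
    using s by (auto simp: simple_function_def measurable_count_space_eq2)
  show "countable (s ` space M)"
    using s by (simp add: simple_function_def countable_finite)
qed

text \<open>The library proves this for second countable spaces only, because a difference of Borel
  maps need not be Borel measurable in general.\<close>

lemma simple_bochner_integral_dist_le:
  fixes f s t :: "'a \<Rightarrow> 'b::real_normed_vector"
  assumes f: "f \<in> borel_measurable M"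
    and s: "Bochner_Integration.simple_bochner_integrable M s"
    and t: "Bochner_Integration.simple_bochner_integrable M t"
  shows "ennreal (norm (Bochner_Integration.simple_bochner_integral M s
           - Bochner_Integration.simple_bochner_integral M t))
         \<le> (\<integral>\<^sup>+x. norm (f x - s x) \<partial>M) + (\<integral>\<^sup>+x. norm (f x - t x) \<partial>M)"
proof -
  have "ennreal (norm (Bochner_Integration.simple_bochner_integral M s
           - Bochner_Integration.simple_bochner_integral M t))
      = norm (Bochner_Integration.simple_bochner_integral M (\<lambda>x. s x - t x))"
    using s t by (subst simple_bochner_integral_diff) auto
  also have "\<dots> \<le> Bochner_Integration.simple_bochner_integral M (\<lambda>x. norm (s x - t x))"
    using simple_bochner_integrable_compose2[of "(-)" M s t] s t
    by (auto intro!: simple_bochner_integral_norm_bound)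
  also have "\<dots> = (\<integral>\<^sup>+x. norm (s x - t x) \<partial>M)"
    using simple_bochner_integrable_compose2[of "\<lambda>x y. norm (x - y)" M s t] s t
    by (auto intro!: simple_bochner_integral_eq_nn_integral)
  also have "\<dots> \<le> (\<integral>\<^sup>+x. ennreal (norm (f x - s x)) + ennreal (norm (f x - t x)) \<partial>M)"
  proof (rule nn_integral_mono)
    fix x
    have "norm (s x - t x) \<le> norm (f x - s x) + norm (f x - t x)"
      by (metis dual_order.refl norm_diff_triangle_le norm_minus_commute)
    then show "ennreal (norm (s x - t x)) \<le> ennreal (norm (f x - s x)) + ennreal (norm (f x - t x))"
      by (simp flip: ennreal_plus)
  qed
  also have "\<dots> = (\<integral>\<^sup>+x. norm (f x - s x) \<partial>M) + (\<integral>\<^sup>+x. norm (f x - t x) \<partial>M)"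
    using borel_measurable_norm_diff_simple[OF f simple_bochner_integrable_simple[OF s]]
      borel_measurable_norm_diff_simple[OF f simple_bochner_integrable_simple[OF t]]
    by (intro nn_integral_add) simp_all
  finally show ?thesis .
qed

text \<open>This is the previous inequality along the sequence that defines \<open>z\<close>: the
  error of that sequence tends to 0, so only the error of \<open>g\<close> survives. Both uniqueness
  of the integral and the estimate for averages rest on it.\<close>

lemma has_banach_integral_dist_simple_le:
  assumes z: "has_banach_integral M f z"
    and g: "Bochner_Integration.simple_bochner_integrable M g"
  shows "ennreal (norm (z - Bochner_Integration.simple_bochner_integral M g))
         \<le> (\<integral>\<^sup>+x. norm (f x - g x) \<partial>M)"
proof -
  from z obtain s where f: "f \<in> borel_measurable M"
    and s: "\<And>n. Bochner_Integration.simple_bochner_integrable M (s n)"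
    and err: "(\<lambda>n. \<integral>\<^sup>+x. ennreal (norm (f x - s n x)) \<partial>M) \<longlonglongrightarrow> 0"
    and lim: "(\<lambda>n. Bochner_Integration.simple_bochner_integral M (s n)) \<longlonglongrightarrow> z"
    unfolding has_banach_integral_def strongly_measurable_def by auto
  have "(\<lambda>n. ennreal (norm (Bochner_Integration.simple_bochner_integral M (s n)
           - Bochner_Integration.simple_bochner_integral M g)))
        \<longlonglongrightarrow> ennreal (norm (z - Bochner_Integration.simple_bochner_integral M g))"
    by (intro tendsto_intros lim)
  moreover have "(\<lambda>n. (\<integral>\<^sup>+x. ennreal (norm (f x - s n x)) \<partial>M) + (\<integral>\<^sup>+x. ennreal (norm (f x - g x)) \<partial>M))
        \<longlonglongrightarrow> 0 + (\<integral>\<^sup>+x. norm (f x - g x) \<partial>M)"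
    by (intro tendsto_add err tendsto_const)
  ultimately have "ennreal (norm (z - Bochner_Integration.simple_bochner_integral M g))
        \<le> 0 + (\<integral>\<^sup>+x. norm (f x - g x) \<partial>M)"
    by (rule LIMSEQ_le) (use simple_bochner_integral_dist_le[OF f s g] in auto)
  then show ?thesis by simp
qed

text \<open>The simple maps that define \<open>z'\<close> also approximate \<open>f\<close> in mean,
  so by the previous bound their integrals converge to \<open>z\<close> as well.\<close>

lemma has_banach_integral_unique:
  assumes z: "has_banach_integral M f z" and z': "has_banach_integral M f z'"
  shows "z = z'"
proof -
  from z' obtain s where
    s: "\<And>n. Bochner_Integration.simple_bochner_integrable M (s n)"
    and err: "(\<lambda>n. \<integral>\<^sup>+x. ennreal (norm (f x - s n x)) \<partial>M) \<longlonglongrightarrow> 0"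
    and lim: "(\<lambda>n. Bochner_Integration.simple_bochner_integral M (s n)) \<longlonglongrightarrow> z'"
    unfolding has_banach_integral_def by auto
  have "(\<lambda>n. ennreal (norm (z - Bochner_Integration.simple_bochner_integral M (s n))))
        \<longlonglongrightarrow> ennreal (norm (z - z'))"
    by (intro tendsto_intros lim)
  from LIMSEQ_le[OF this err] have "ennreal (norm (z - z')) \<le> 0"
    using has_banach_integral_dist_simple_le[OF z s] by blast
  then show ?thesis by (simp add: ennreal_eq_0_iff)
qed

lemma banach_integral_eq:
  assumes "has_banach_integral M f z"
  shows "banach_integral M f = z"
proof -
  have "(THE z. has_banach_integral M f z) = z"
    using assms has_banach_integral_unique[OF _ assms] by (rule the_equality)
  then show ?thesis unfolding banach_integral_def using assms by (metis (full_types))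
qed

text \<open>Almost everywhere convergence of simple maps is upgraded to convergence in mean, by
  truncation and dominated convergence. The integrals of the truncated maps then form a Cauchy
  sequence, and completeness of the space gives the limit.\<close>

lemma has_banach_integral_exists:
  assumes f: "strongly_measurable M f" and fin: "(\<integral>\<^sup>+x. norm (f x) \<partial>M) < \<infinity>"
  shows "\<exists>z. has_banach_integral M f z"
proof -
  from f obtain s where fm: "f \<in> borel_measurable M"
    and s: "\<And>n. Bochner_Integration.simple_bochner_integrable M (s n)"
    and lim: "AE x in M. (\<lambda>n. s n x) \<longlonglongrightarrow> f x"
    unfolding strongly_measurable_def by auto
  note nf = measurable_compose[OF fm borel_measurable_norm]
  \<comment> \<open>Truncating at twice the norm of \<open>f\<close> makes dominated convergence applicable.\<close>
  define t where "t n x = (if norm (s n x) \<le> 2 * norm (f x) then s n x else 0)" for n x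
  have t_simple: "simple_function M (t n)" for n
  proof -
    have [measurable]: "(\<lambda>x. norm (f x)) \<in> borel_measurable M" by (rule nf)
    have [measurable]: "(\<lambda>x. norm (s n x)) \<in> borel_measurable M"
      by (rule borel_measurable_simple_function)
        (rule simple_function_compose1[OF simple_bochner_integrable_simple[OF s]])
    have "{x\<in>space M. norm (s n x) \<le> 2 * norm (f x)} \<in> sets M" by measurable
    then show ?thesis
      unfolding t_def using simple_bochner_integrable_simple[OF s]
      by (intro simple_function_If) auto
  qed
  have t: "Bochner_Integration.simple_bochner_integrable M (t n)" for n
  proof (rule simple_bochner_integrable.intros[OF t_simple])
    \<comment> \<open>Measurability into the discrete space makes the support of \<open>s n\<close>
      a measurable set. It contains the support of \<open>t n\<close>.\<close>
    have sm: "s n \<in> measurable M (count_space UNIV)"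
      using simple_bochner_integrable_simple[OF s] by (rule measurable_simple_function)
    have "emeasure M {y \<in> space M. t n y \<noteq> 0} \<le> emeasure M {y \<in> space M. s n y \<noteq> 0}"
      using sm by (intro emeasure_mono) (auto simp: t_def)
    also have "\<dots> < \<infinity>"
      using s[of n] by (auto elim!: simple_bochner_integrable.cases simp: less_top)
    finally show "emeasure M {y \<in> space M. t n y \<noteq> 0} \<noteq> \<infinity>" by simp
  qed
  have t_lim: "AE x in M. (\<lambda>n. t n x) \<longlonglongrightarrow> f x"
    using lim
  proof eventually_elim
    fix x assume x: "(\<lambda>n. s n x) \<longlonglongrightarrow> f x"
    show "(\<lambda>n. t n x) \<longlonglongrightarrow> f x"
    proof (cases "f x = 0")
      case True
      \<comment> \<open>Where \<open>f\<close> vanishes, the truncation only keeps values of norm 0,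
        so \<open>t n x\<close> is constantly 0.\<close>
      then have "(\<lambda>n. t n x) = (\<lambda>n. f x)" by (auto simp: t_def)
      then show ?thesis by simp
    next
      case False
      \<comment> \<open>The factor 2 leaves room above the limit of \<open>norm (s n x)\<close>, so
        the truncation is eventually inactive at \<open>x\<close>.\<close>
      then have "norm (f x) < 2 * norm (f x)" by simp
      from order_tendstoD(2)[OF tendsto_norm[OF x] this]
      have "eventually (\<lambda>n. s n x = t n x) sequentially"
        by eventually_elim (simp add: t_def)
      then show ?thesis using x by (simp add: tendsto_cong)
    qed
  qed
  have err: "(\<lambda>n. \<integral>\<^sup>+x. ennreal (norm (f x - t n x)) \<partial>M) \<longlonglongrightarrow> (\<integral>\<^sup>+(x::'a). 0 \<partial>M)"
  \<comment> \<open>The factor 3 is 1 for \<open>f\<close> plus 2 for the truncated map.\<close>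
  proof (rule nn_integral_dominated_convergence[where w = "\<lambda>x. 3 * ennreal (norm (f x))"])
    show "(\<lambda>x. ennreal (norm (f x - t n x))) \<in> borel_measurable M" for n
      using borel_measurable_norm_diff_simple[OF fm t_simple] by simp
    show "(\<lambda>x. 3 * ennreal (norm (f x))) \<in> borel_measurable M"
      using nf by simp
    have "(\<integral>\<^sup>+x. 3 * ennreal (norm (f x)) \<partial>M) = 3 * (\<integral>\<^sup>+x. ennreal (norm (f x)) \<partial>M)"
      using nf by (intro nn_integral_cmult) simp
    then show "(\<integral>\<^sup>+x. 3 * ennreal (norm (f x)) \<partial>M) < \<infinity>"
      using fin by (simp add: ennreal_mult_less_top)
    show "AE x in M. ennreal (norm (f x - t n x)) \<le> 3 * ennreal (norm (f x))" for n
    proof (rule AE_I2)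
      fix x
      have "norm (f x - t n x) \<le> norm (f x) + norm (t n x)" by (rule norm_triangle_ineq4)
      also have "\<dots> \<le> 3 * norm (f x)" by (simp add: t_def)
      finally have "ennreal (norm (f x - t n x)) \<le> ennreal (3 * norm (f x))"
        by (rule ennreal_leI)
      then show "ennreal (norm (f x - t n x)) \<le> 3 * ennreal (norm (f x))"
        by (simp add: ennreal_mult)
    qed
    show "AE x in M. (\<lambda>n. ennreal (norm (f x - t n x))) \<longlonglongrightarrow> 0"
      using t_lim
    proof eventually_elim
      fix x assume "(\<lambda>n. t n x) \<longlonglongrightarrow> f x"
      then have "(\<lambda>n. ennreal (norm (f x - t n x))) \<longlonglongrightarrow> ennreal (norm (f x - f x))"
        by (intro tendsto_intros)
      then show "(\<lambda>n. ennreal (norm (f x - t n x))) \<longlonglongrightarrow> 0" by simp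
    qed
  qed simp
  then have err0: "(\<lambda>n. \<integral>\<^sup>+x. ennreal (norm (f x - t n x)) \<partial>M) \<longlonglongrightarrow> 0" by simp
  have "Cauchy (\<lambda>n. Bochner_Integration.simple_bochner_integral M (t n))"
  proof (rule metric_CauchyI)
    fix e :: real assume e: "0 < e"
    then have "eventually (\<lambda>n. (\<integral>\<^sup>+x. ennreal (norm (f x - t n x)) \<partial>M) < ennreal (e / 2)) sequentially"
      by (intro order_tendstoD(2)[OF err0]) simp
    then obtain N where N: "\<And>n. N \<le> n \<Longrightarrow> (\<integral>\<^sup>+x. ennreal (norm (f x - t n x)) \<partial>M) < ennreal (e / 2)"
      unfolding eventually_sequentially by auto
    show "\<exists>N. \<forall>m\<ge>N. \<forall>n\<ge>N. dist (Bochner_Integration.simple_bochner_integral M (t m))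
        (Bochner_Integration.simple_bochner_integral M (t n)) < e"
    proof (intro exI[of _ N] allI impI)
      fix m n assume "N \<le> m" "N \<le> n"
      have "ennreal (dist (Bochner_Integration.simple_bochner_integral M (t m))
          (Bochner_Integration.simple_bochner_integral M (t n)))
          \<le> (\<integral>\<^sup>+x. norm (f x - t m x) \<partial>M) + (\<integral>\<^sup>+x. norm (f x - t n x) \<partial>M)"
        unfolding dist_norm by (rule simple_bochner_integral_dist_le[OF fm t t])
      also have "\<dots> < ennreal (e / 2) + ennreal (e / 2)"
        using N[OF \<open>N \<le> m\<close>] N[OF \<open>N \<le> n\<close>] by (intro add_strict_mono)
      also have "\<dots> = ennreal e" using e by (simp flip: ennreal_plus)
      finally show "dist (Bochner_Integration.simple_bochner_integral M (t m))
        (Bochner_Integration.simple_bochner_integral M (t n)) < e"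
        using e by (simp add: ennreal_less_iff)
    qed
  qed
  then obtain z where "(\<lambda>n. Bochner_Integration.simple_bochner_integral M (t n)) \<longlonglongrightarrow> z"
    using Cauchy_convergent_iff convergent_def by blast
  then show ?thesis
    unfolding has_banach_integral_def using f t err0 by blast
qed

section \<open>Restrictions to sets of finite measure and their averages\<close>

lemma strongly_measurable_indicator_scaleR:
  assumes f: "strongly_measurable M f" and J: "J \<in> sets M"
  shows "strongly_measurable M (\<lambda>x. indicator J x *\<^sub>R f x)"
proof -
  from f obtain s where fm: "f \<in> borel_measurable M"
    and s: "\<And>n. Bochner_Integration.simple_bochner_integrable M (s n)"
    and lim: "AE x in M. (\<lambda>n. s n x) \<longlonglongrightarrow> f x"
    unfolding strongly_measurable_def by auto
  \<comment> \<open>As a case distinction the product is measurable for any target space, and the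
    same rewriting serves \<open>f\<close> and each \<open>s n\<close>.\<close>
  have eq: "(\<lambda>x. indicator J x *\<^sub>R g x) = (\<lambda>x. if x \<in> J then g x else 0)" for g :: "'a \<Rightarrow> 'b"
    by auto
  have JJ: "{x \<in> space M. x \<in> J} \<in> sets M"
    using J by simp
  have "(\<lambda>x. indicator J x *\<^sub>R f x) \<in> borel_measurable M"
    unfolding eq using fm JJ by (intro measurable_If) auto
  moreover have "Bochner_Integration.simple_bochner_integrable M (\<lambda>x. indicator J x *\<^sub>R s n x)" for n
  proof (rule simple_bochner_integrable.intros)
    show "simple_function M (\<lambda>x. indicator J x *\<^sub>R s n x)"
      unfolding eq using simple_bochner_integrable_simple[OF s] JJ by (intro simple_function_If) auto
    have sm: "s n \<in> measurable M (count_space UNIV)"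
      using simple_bochner_integrable_simple[OF s] by (rule measurable_simple_function)
    have "emeasure M {y \<in> space M. indicator J y *\<^sub>R s n y \<noteq> 0} \<le> emeasure M {y \<in> space M. s n y \<noteq> 0}"
      using sm by (intro emeasure_mono) auto
    also have "\<dots> < \<infinity>"
      using s[of n] by (auto elim!: simple_bochner_integrable.cases simp: less_top)
    finally show "emeasure M {y \<in> space M. indicator J y *\<^sub>R s n y \<noteq> 0} \<noteq> \<infinity>" by simp
  qed
  moreover have "AE x in M. (\<lambda>n. indicator J x *\<^sub>R s n x) \<longlonglongrightarrow> indicator J x *\<^sub>R f x"
    using lim by eventually_elim (intro tendsto_intros)
  ultimately show ?thesis
    unfolding strongly_measurable_def by (intro conjI exI[of _ "\<lambda>n x. indicator J x *\<^sub>R s n x"]) auto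
qed

text \<open>It ensures that averages over basis sets are genuine integrals and not the default 0 of
  \<open>banach_integral\<close>. On a set of finite measure a bounded map is integrable; for finite
  \<open>p\<close> the elementary bound at exponent \<open>q\<close> below takes the place of
  Hoelder's inequality.\<close>

lemma Lp_maps_locally_integrable:
  assumes w: "w \<in> Lp_maps M p" and p: "1 \<le> p"
    and J: "J \<in> sets M" "emeasure M J < \<infinity>"
  shows "(\<integral>\<^sup>+x. norm (indicator J x *\<^sub>R w x) \<partial>M) < \<infinity>"
proof (cases "p = \<infinity>")
  case True
  with w have "bounded (w ` space M)" by (simp add: Lp_maps_def)
  then obtain C where C: "\<And>x. x \<in> space M \<Longrightarrow> norm (w x) \<le> C"
    unfolding bounded_iff by auto
  have "(\<integral>\<^sup>+x. norm (indicator J x *\<^sub>R w x) \<partial>M) \<le> (\<integral>\<^sup>+x. ennreal C * indicator J x \<partial>M)"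
    using C by (intro nn_integral_mono) (auto split: split_indicator intro: ennreal_leI)
  also have "\<dots> = ennreal C * emeasure M J"
    using J by (simp add: nn_integral_cmult_indicator)
  also have "\<dots> < \<infinity>" using J by (simp add: ennreal_mult_less_top)
  finally show ?thesis .
next
  case False
  define q where "q = enn2real p"
  have q: "1 \<le> q"
    using p False unfolding q_def
    by (metis enn2real_1 enn2real_mono infinity_ennreal_def less_top)
  from w False have int: "integrable M (\<lambda>x. norm (w x) powr q)"
    by (simp add: Lp_maps_def q_def)
  have "(\<integral>\<^sup>+x. norm (indicator J x *\<^sub>R w x) \<partial>M)
      \<le> (\<integral>\<^sup>+x. indicator J x + ennreal (norm (w x) powr q) \<partial>M)"
  proof (rule nn_integral_mono)
    fix x
    \<comment> \<open>Small values are bounded by 1, and values above 1 by their \<open>q\<close>-th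
      power since \<open>1 \<le> q\<close>. The summand 1 is integrable over \<open>J\<close>, the
      power over the whole space.\<close>
    have "norm (w x) \<le> 1 + norm (w x) powr q"
    proof (cases "norm (w x) \<le> 1")
      case True
      then show ?thesis by (simp add: add_increasing2)
    next
      case False
      then have "norm (w x) powr 1 \<le> norm (w x) powr q"
        using q by (intro powr_mono) auto
      then show ?thesis using False by simp
    qed
    then have "ennreal (norm (w x)) \<le> ennreal (1 + norm (w x) powr q)" by (rule ennreal_leI)
    also have "\<dots> = 1 + ennreal (norm (w x) powr q)" by simp
    finally show "ennreal (norm (indicator J x *\<^sub>R w x)) \<le> indicator J x + ennreal (norm (w x) powr q)"
      by (auto split: split_indicator)
  qed
  also have "\<dots> = emeasure M J + (\<integral>\<^sup>+x. ennreal (norm (w x) powr q) \<partial>M)"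
    using J int by (subst nn_integral_add) auto
  also have "\<dots> < \<infinity>"
    using J int by (simp add: integrable_iff_bounded)
  finally show ?thesis .
qed

text \<open>The map equal to \<open>d\<close> on \<open>J\<close> and 0 elsewhere is simple with
  average \<open>d\<close>, so comparing integrals with it bounds the distance by the mean of
  \<open>norm (w x - d)\<close> over \<open>J\<close>. Besides differentiation, the case
  \<open>d = 0\<close> yields the uniform bound needed for \<open>p = \<infinity>\<close>.\<close>

lemma banach_average_dist_le:
  assumes w: "w \<in> Lp_maps M p" and p: "1 \<le> p"
    and J: "J \<in> sets M" "0 < emeasure M J" "emeasure M J < \<infinity>"
    and e: "0 \<le> e" and close: "AE x in M. x \<in> J \<longrightarrow> norm (w x - d) \<le> e"
  shows "norm ((1 / measure M J) *\<^sub>R banach_integral M (\<lambda>x. indicator J x *\<^sub>R w x) - d) \<le> e"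
proof -
  let ?f = "\<lambda>x. indicator J x *\<^sub>R w x" and ?g = "\<lambda>x. indicator J x *\<^sub>R d"
  let ?m = "measure M J"
  have em: "emeasure M J = ennreal ?m"
    using J by (intro emeasure_eq_ennreal_measure) auto
  then have m: "0 < ?m" using J by simp
  from w have "strongly_measurable M w" by (simp add: Lp_maps_def)
  then have "strongly_measurable M ?f" using J by (intro strongly_measurable_indicator_scaleR)
  then obtain z where z: "has_banach_integral M ?f z"
    using has_banach_integral_exists Lp_maps_locally_integrable[OF w p J(1,3)] by blast
  have ind: "Bochner_Integration.simple_bochner_integrable M (indicator J :: 'a \<Rightarrow> real)"
  proof
    show "simple_function M (indicator J :: 'a \<Rightarrow> real)"
      using J by (intro simple_function_indicator)
    have "{y \<in> space M. indicator J y \<noteq> (0::real)} = J"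
      using sets.sets_into_space[OF J(1)] by (auto split: split_indicator)
    then show "emeasure M {y \<in> space M. indicator J y \<noteq> (0::real)} \<noteq> \<infinity>" using J by simp
  qed
  \<comment> \<open>The second argument of the binary combination is a dummy: the indicator is
    passed twice and used once.\<close>
  have g: "Bochner_Integration.simple_bochner_integrable M ?g"
    using simple_bochner_integrable_compose2[where p = "\<lambda>a b. a *\<^sub>R d", OF _ ind ind] by simp
  have "ennreal (Bochner_Integration.simple_bochner_integral M (indicator J)) = emeasure M J"
    using simple_bochner_integral_eq_nn_integral[OF ind] J by (simp add: ennreal_indicator)
  then have "Bochner_Integration.simple_bochner_integral M (indicator J) = ?m"
    by (simp add: em)
  moreover have "Bochner_Integration.simple_bochner_integral M ?g
      = Bochner_Integration.simple_bochner_integral M (indicator J) *\<^sub>R d"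
    by (rule simple_bochner_integral_linear[OF _ ind]) (simp add: linear_iff scaleR_add_left)
  ultimately have Sg: "Bochner_Integration.simple_bochner_integral M ?g = ?m *\<^sub>R d" by simp
  have "ennreal (norm (z - ?m *\<^sub>R d)) \<le> (\<integral>\<^sup>+x. norm (?f x - ?g x) \<partial>M)"
    using has_banach_integral_dist_simple_le[OF z g] unfolding Sg .
  also have "\<dots> \<le> (\<integral>\<^sup>+x. ennreal e * indicator J x \<partial>M)"
    using close by (intro nn_integral_mono_AE, eventually_elim)
      (auto split: split_indicator intro: ennreal_leI)
  also have "\<dots> = ennreal (e * ?m)"
    using J e by (simp add: nn_integral_cmult_indicator em ennreal_mult)
  finally have "norm (z - ?m *\<^sub>R d) \<le> e * ?m"
    using e m by (simp add: ennreal_le_iff)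
  moreover have "(1 / ?m) *\<^sub>R z - d = (1 / ?m) *\<^sub>R (z - ?m *\<^sub>R d)"
    using m by (simp add: scaleR_diff_right)
  ultimately show ?thesis
    using m by (simp add: banach_integral_eq[OF z] divide_le_eq)
qed

section \<open>The differentiation basis of a lifting\<close>

lemma von_neumann_liftingD:
  assumes "von_neumann_lifting M l"
  shows "l {} = {}"
    and "\<And>E. E \<in> sets M \<Longrightarrow> l E \<in> sets M"
    and "\<And>E. E \<in> sets M \<Longrightarrow> emeasure M (sym_diff E (l E)) = 0"
    and "\<And>E F. E \<in> sets M \<Longrightarrow> F \<in> sets M \<Longrightarrow> l (E \<inter> F) = l E \<inter> l F"
    and "\<And>E F. E \<in> sets M \<Longrightarrow> F \<in> sets M \<Longrightarrow> emeasure M (sym_diff E F) = 0 \<Longrightarrow> l E = l F"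
proof -
  from assms have 1: "l {} = {}"
    and 2: "\<forall>E\<in>sets M. l E \<in> sets M"
    and 3: "\<forall>E\<in>sets M. emeasure M (sym_diff E (l E)) = 0"
    and 4: "\<forall>E\<in>sets M. \<forall>F\<in>sets M. l (E \<inter> F) = l E \<inter> l F \<and> l (E \<union> F) = l E \<union> l F"
    and 5: "\<forall>E\<in>sets M. \<forall>F\<in>sets M. emeasure M (sym_diff E F) = 0 \<longrightarrow> l E = l F"
    unfolding von_neumann_lifting_def by - (elim conjE, assumption)+
  show "l {} = {}" by (rule 1)
  show "l E \<in> sets M" if "E \<in> sets M" for E using 2 that by (rule bspec)
  show "emeasure M (sym_diff E (l E)) = 0" if "E \<in> sets M" for E using 3 that by (rule bspec)
  show "l (E \<inter> F) = l E \<inter> l F" if "E \<in> sets M" "F \<in> sets M" for E F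
    using bspec[OF bspec[OF 4 that(1)] that(2)] by (rule conjunct1)
  show "l E = l F" if "E \<in> sets M" "F \<in> sets M" "emeasure M (sym_diff E F) = 0" for E F
    using bspec[OF bspec[OF 5 that(1)] that(2)] that(3) by (rule mp)
qed

text \<open>In this almost everywhere form the lifting property can be combined over countably many
  sets.\<close>

lemma lifting_AE_iff:
  assumes "von_neumann_lifting M l" and "A \<in> sets M"
  shows "AE x in M. x \<in> l A \<longleftrightarrow> x \<in> A"
proof -
  have "sym_diff A (l A) \<in> null_sets M"
    using assms(2) von_neumann_liftingD(2,3)[OF assms] by (intro null_setsI) auto
  from AE_not_in[OF this] show ?thesis by eventually_elim auto
qed

text \<open>A basis set \<open>l F\<close> agrees with \<open>F\<close> up to a null set, so it
  inherits the measure of \<open>F\<close>.\<close>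

lemma lifting_basisD:
  assumes l: "von_neumann_lifting M l" and J: "J \<in> lifting_basis M l"
  shows "J \<in> sets M" "0 < emeasure M J" "emeasure M J < \<infinity>"
proof -
  from J obtain F where F: "F \<in> sets M" "0 < emeasure M F" "emeasure M F < \<infinity>" "J = l F"
    unfolding lifting_basis_def by auto
  then have J: "J \<in> sets M" using von_neumann_liftingD(2)[OF l] by simp
  have "AE x in M. x \<in> F \<longleftrightarrow> x \<in> J"
    using lifting_AE_iff[OF l F(1)] unfolding F(4) by eventually_elim simp
  then have "emeasure M F = emeasure M J" using F(1) J by (intro emeasure_eq_AE)
  with J F show "J \<in> sets M" "0 < emeasure M J" "emeasure M J < \<infinity>" by auto
qed

text \<open>Positive measure comes for free: if \<open>A\<close> were null, then
  \<open>l A = l {} = {}\<close> could not contain \<open>x\<close>. A single point of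
  \<open>l A\<close> thus certifies that \<open>l A\<close> is a basis set.\<close>

lemma lifting_in_basis_at:
  assumes l: "von_neumann_lifting M l" and A: "A \<in> sets M" "emeasure M A < \<infinity>" and x: "x \<in> l A"
  shows "l A \<in> basis_at M l x"
proof -
  have "emeasure M A \<noteq> 0"
  proof
    assume "emeasure M A = 0"
    then have "emeasure M (sym_diff A {}) = 0" by simp
    then have "l A = l {}"
      by (intro von_neumann_liftingD(5)[OF l A(1)]) auto
    then show False using von_neumann_liftingD(1)[OF l] x by simp
  qed
  then show ?thesis
    using A x unfolding basis_at_def lifting_basis_def by (auto simp: zero_less_iff_neq_zero)
qed

text \<open>The basis at a point is directed downwards. By multiplicativity the intersection is the
  lifting of \<open>F \<inter> F'\<close>, and the common point \<open>x\<close> forces that set to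
  have positive measure.\<close>

lemma basis_at_Int:
  assumes l: "von_neumann_lifting M l" and "I \<in> basis_at M l x" "I' \<in> basis_at M l x"
  shows "I \<inter> I' \<in> basis_at M l x"
proof -
  from assms obtain F F' where F: "F \<in> sets M" "emeasure M F < \<infinity>" "I = l F"
    and F': "F' \<in> sets M" "emeasure M F' < \<infinity>" "I' = l F'" and x: "x \<in> I" "x \<in> I'"
    unfolding basis_at_def lifting_basis_def by auto
  have eq: "I \<inter> I' = l (F \<inter> F')"
    using von_neumann_liftingD(4)[OF l F(1) F'(1)] F(3) F'(3) by simp
  have "emeasure M (F \<inter> F') \<le> emeasure M F" using F by (intro emeasure_mono) auto
  then have "emeasure M (F \<inter> F') < \<infinity>" using F by (auto intro: le_less_trans)
  then show ?thesis
    using lifting_in_basis_at[OF l, of "F \<inter> F'" x] x F F' eq by auto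
qed

section \<open>Limits along the differentiation basis\<close>

lemma has_basis_limitD:
  assumes "has_basis_limit M l x \<Phi> z" "open U" "z \<in> U"
  shows "\<exists>I\<in>basis_at M l x. \<forall>J\<in>basis_nhd M l x I. \<Phi> J \<in> U"
  using assms unfolding has_basis_limit_def by simp

text \<open>By directedness, \<open>I \<inter> I'\<close> is a basis set below both witnesses, so
  its value would lie in two disjoint neighbourhoods.\<close>

lemma has_basis_limit_unique:
  assumes l: "von_neumann_lifting M l"
    and "has_basis_limit M l x \<Phi> z" "has_basis_limit M l x \<Phi> z'"
  shows "z = z'"
proof (rule ccontr)
  assume "z \<noteq> z'"
  from hausdorff[OF this] obtain U U' where
    U: "open U" "z \<in> U" "open U'" "z' \<in> U'" "U \<inter> U' = {}" by blast
  obtain I where I: "I \<in> basis_at M l x" "\<And>J. J \<in> basis_nhd M l x I \<Longrightarrow> \<Phi> J \<in> U"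
    using has_basis_limitD[OF assms(2) U(1,2)] by blast
  obtain I' where I': "I' \<in> basis_at M l x" "\<And>J. J \<in> basis_nhd M l x I' \<Longrightarrow> \<Phi> J \<in> U'"
    using has_basis_limitD[OF assms(3) U(3,4)] by blast
  have "I \<inter> I' \<in> basis_at M l x" using basis_at_Int[OF l I(1) I'(1)] .
  then have "\<Phi> (I \<inter> I') \<in> U \<inter> U'"
    using I(2) I'(2) by (auto simp: basis_nhd_def)
  then show False using U by simp
qed

text \<open>Each basis set \<open>I\<close> is a member of its own neighbourhood family, so every
  neighbourhood of the limit contains some value of \<open>\<Phi>\<close>. A uniform bound on
  averages therefore passes to their limits.\<close>

lemma has_basis_limit_norm_le:
  fixes z :: "'b::real_normed_vector"
  assumes lim: "has_basis_limit M l x \<Phi> z"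
    and le: "\<And>J. J \<in> basis_at M l x \<Longrightarrow> norm (\<Phi> J) \<le> C"
  shows "norm z \<le> C"
proof (rule ccontr)
  assume "\<not> norm z \<le> C"
  then have "z \<in> {y. C < norm y}" by simp
  moreover have "open {y::'b. C < norm y}" by (intro open_Collect_less continuous_intros)
  ultimately obtain I where I: "I \<in> basis_at M l x" "\<forall>J\<in>basis_nhd M l x I. \<Phi> J \<in> {y. C < norm y}"
    using has_basis_limitD[OF lim] by meson
  then have "I \<in> basis_nhd M l x I" by (simp add: basis_nhd_def)
  with I le[of I] show False by auto
qed

section \<open>Differentiation\<close>

text \<open>This is essential separability of the range: each approximating simple map has finitely
  many values on \<open>space M\<close>, and \<open>D\<close> collects all of them.\<close>

lemma strongly_measurable_AE_approx:
  assumes "strongly_measurable M w"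
  obtains D where "countable D" "AE x in M. \<forall>e>0. \<exists>d\<in>D. norm (w x - d) < e"
proof -
  from assms obtain s where
    s: "\<And>n. Bochner_Integration.simple_bochner_integrable M (s n)"
    and lim: "AE x in M. (\<lambda>n. s n x) \<longlonglongrightarrow> w x"
    unfolding strongly_measurable_def by auto
  let ?D = "\<Union>n. s n ` space M"
  have "countable ?D"
    using simple_bochner_integrable_simple[OF s]
    by (intro countable_UN) (auto simp: simple_function_def countable_finite)
  moreover have "AE x in M. \<forall>e>0. \<exists>d\<in>?D. norm (w x - d) < e"
    using lim AE_space
  proof eventually_elim
    fix x assume x: "(\<lambda>n. s n x) \<longlonglongrightarrow> w x" "x \<in> space M"
    show "\<forall>e>0. \<exists>d\<in>?D. norm (w x - d) < e"
    proof (intro allI impI)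
      fix e :: real assume "0 < e"
      then obtain n where "norm (s n x - w x) < e"
        using LIMSEQ_D[OF x(1)] by blast
      then show "\<exists>d\<in>?D. norm (w x - d) < e"
        using x(2) by (auto simp: norm_minus_commute)
    qed
  qed
  ultimately show thesis by (rule that)
qed

lemma lifting_differentiation:
  assumes sf: "sigma_finite_measure M" and l: "von_neumann_lifting M l"
    and w: "w \<in> Lp_maps M p" and p: "1 \<le> p"
  shows "AE x in M. x \<in> basis_domain M l \<and> has_basis_limit M l x
    (\<lambda>I. (1 / measure M I) *\<^sub>R banach_integral M (\<lambda>y. indicator I y *\<^sub>R w y)) (w x)"
proof -
  let ?avg = "\<lambda>I. (1 / measure M I) *\<^sub>R banach_integral M (\<lambda>y. indicator I y *\<^sub>R w y)"
  interpret sigma_finite_measure M by fact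
  obtain X :: "nat \<Rightarrow> 'a set" where X: "range X \<subseteq> sets M" "(\<Union>i. X i) = space M"
    "\<And>i. emeasure M (X i) \<noteq> \<infinity>"
    using sigma_finite by metis
  from w have sm: "strongly_measurable M w" by (simp add: Lp_maps_def)
  then have wm: "w \<in> borel_measurable M" by (simp add: strongly_measurable_def)
  obtain D where D: "countable D" "AE x in M. \<forall>e>0. \<exists>d\<in>D. norm (w x - d) < e"
    using strongly_measurable_AE_approx[OF sm] .
  \<comment> \<open>Here \<open>d\<close> is the approximate value and \<open>k\<close> the
    precision; intersecting with \<open>X i\<close> makes the measure finite, as membership of the
    lifted set in the basis requires.\<close>
  define A where "A d i k = {x \<in> space M. norm (w x - d) < 1 / Suc k} \<inter> X i" for d i and k :: nat
  have A: "A d i k \<in> sets M" "emeasure M (A d i k) < \<infinity>" for d i k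
  proof -
    have "(\<lambda>y. norm (y - d)) \<in> borel_measurable borel"
      by (intro borel_measurable_continuous_onI continuous_intros)
    from measurable_compose[OF wm this]
    have [measurable]: "(\<lambda>x. norm (w x - d)) \<in> borel_measurable M" .
    have [measurable]: "X i \<in> sets M" using X(1) by auto
    show "A d i k \<in> sets M" unfolding A_def by measurable
    have "emeasure M (A d i k) \<le> emeasure M (X i)"
      by (intro emeasure_mono) (auto simp: A_def)
    then show "emeasure M (A d i k) < \<infinity>" using X(3)[of i] by (simp add: less_top le_less_trans)
  qed
  \<comment> \<open>Countability of \<open>D\<close> gives one exceptional null set for all
    \<open>d\<close>, \<open>i\<close> and \<open>k\<close> at once; from here on the argument is
    pointwise in \<open>x\<close>.\<close>
  have "AE x in M. \<forall>d\<in>D. \<forall>i k. x \<in> l (A d i k) \<longleftrightarrow> x \<in> A d i k"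
    using lifting_AE_iff[OF l A(1)] D(1) by (simp add: AE_ball_countable AE_all_countable)
  then show ?thesis
    using D(2) AE_space
  proof eventually_elim
    fix x
    assume lx: "\<forall>d\<in>D. \<forall>i k. x \<in> l (A d i k) \<longleftrightarrow> x \<in> A d i k"
      and dense: "\<forall>e>0. \<exists>d\<in>D. norm (w x - d) < e" and x: "x \<in> space M"
    obtain i where i: "x \<in> X i" using x X(2) by blast
    have ex: "\<exists>I\<in>basis_at M l x. \<forall>J\<in>basis_nhd M l x I. norm (?avg J - w x) < 2 / Suc k" for k
    proof -
      obtain d where d: "d \<in> D" "norm (w x - d) < 1 / Suc k"
        using dense by (metis of_nat_0_less_iff zero_less_Suc zero_less_divide_1_iff)
      then have "x \<in> l (A d i k)" using lx i x by (auto simp: A_def)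
      then have I: "l (A d i k) \<in> basis_at M l x"
        by (intro lifting_in_basis_at[OF l A])
      have "norm (?avg J - w x) < 2 / Suc k" if J: "J \<in> basis_nhd M l x (l (A d i k))" for J
      proof -
        have Jb: "J \<in> lifting_basis M l" and sub: "J \<subseteq> l (A d i k)"
          using J by (auto simp: basis_nhd_def basis_at_def)
        \<comment> \<open>\<open>J\<close> lies inside the lifted set, where closeness to
          \<open>d\<close> can fail only on the null set separating it from
          \<open>A d i k\<close>.\<close>
        have "AE y in M. y \<in> J \<longrightarrow> norm (w y - d) \<le> 1 / Suc k"
          using lifting_AE_iff[OF l A(1)[of d i k]]
          by eventually_elim (use sub in \<open>auto simp: A_def\<close>)
        then have "norm (?avg J - d) \<le> 1 / Suc k"
          by (intro banach_average_dist_le[OF w p lifting_basisD[OF l Jb]]) auto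
        moreover have "norm (?avg J - w x) \<le> norm (?avg J - d) + norm (w x - d)"
          by (metis norm_diff_triangle_le norm_minus_commute order_refl)
        ultimately have "norm (?avg J - w x) < 1 / Suc k + 1 / Suc k" using d(2) by linarith
        then show ?thesis by simp
      qed
      with I show ?thesis by blast
    qed
    have "x \<in> basis_domain M l"
      \<comment> \<open>Any precision will do: the witness shows that the basis at \<open>x\<close>
        is nonempty.\<close>
      using ex[of 0] x by (auto simp: basis_domain_def)
    moreover have "has_basis_limit M l x ?avg (w x)"
      unfolding has_basis_limit_def
    proof (intro allI impI, elim conjE)
      fix U assume "open U" "w x \<in> U"
      then obtain e where e: "0 < e" "\<And>y. norm (y - w x) < e \<Longrightarrow> y \<in> U"
        unfolding open_dist dist_norm by blast
      obtain k where k: "1 / real (Suc k) < e / 2"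
        using nat_approx_posE[of "e / 2"] e(1) by auto
      then have "2 / Suc k < e" by (simp add: field_simps)
      then show "\<exists>I\<in>basis_at M l x. \<forall>J\<in>basis_nhd M l x I. ?avg J \<in> U"
        using ex[of k] e(2) by (meson less_trans)
    qed
    ultimately show "x \<in> basis_domain M l \<and> has_basis_limit M l x ?avg (w x)" by simp
  qed
qed

section \<open>Changing maps on null sets\<close>

lemma borel_measurable_AE_eq_complete:
  fixes f g :: "'a \<Rightarrow> 'b::topological_space"
  assumes M: "complete_measure M" and f: "f \<in> borel_measurable M" and eq: "AE x in M. g x = f x"
  shows "g \<in> borel_measurable M"
proof (rule measurableI)
  fix S :: "'b set" assume S: "S \<in> sets borel"
  show "g -` S \<inter> space M \<in> sets M"
  \<comment> \<open>The two preimages differ inside a null set, so completeness makes the second one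
    measurable. The precise representative, defined pointwise by limits, gets its measurability this
    way.\<close>
  proof (rule complete_measure.in_sets_AE[OF M])
    show "f -` S \<inter> space M \<in> sets M" using f S by (rule measurable_sets)
    show "AE x in M. x \<in> f -` S \<inter> space M \<longleftrightarrow> x \<in> g -` S \<inter> space M"
      using eq by eventually_elim auto
  qed auto
qed auto

lemma strongly_measurable_AE_eq:
  assumes M: "complete_measure M" and f: "strongly_measurable M f" and eq: "AE x in M. g x = f x"
  shows "strongly_measurable M g"
proof -
  from f obtain s where
    s: "\<And>n. Bochner_Integration.simple_bochner_integrable M (s n)"
    and lim: "AE x in M. (\<lambda>n. s n x) \<longlonglongrightarrow> f x"
    unfolding strongly_measurable_def by auto
  have "AE x in M. (\<lambda>n. s n x) \<longlonglongrightarrow> g x"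
    using lim eq by eventually_elim simp
  moreover have "g \<in> borel_measurable M"
    using borel_measurable_AE_eq_complete[OF M _ eq] f by (simp add: strongly_measurable_def)
  ultimately show ?thesis using s unfolding strongly_measurable_def by blast
qed

text \<open>For \<open>p = \<infinity>\<close> the maps are bounded at every point of the space,
  which a change on a null set may destroy; hence the separate assumption
  \<open>bdd\<close>.\<close>

lemma Lp_maps_AE_eq:
  assumes M: "complete_measure M" and f: "f \<in> Lp_maps M p" and eq: "AE x in M. g x = f x"
    and bdd: "p = \<infinity> \<Longrightarrow> bounded (g ` space M)"
  shows "g \<in> Lp_maps M p"
proof -
  have g: "strongly_measurable M g"
    using strongly_measurable_AE_eq[OF M _ eq] f by (simp add: Lp_maps_def)
  have "integrable M (\<lambda>x. norm (g x) powr enn2real p)" if "p \<noteq> \<infinity>"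
  proof -
    have gm: "g \<in> borel_measurable M" using g by (simp add: strongly_measurable_def)
    have "(\<lambda>x. norm (g x)) \<in> borel_measurable M"
      by (rule measurable_compose[OF gm borel_measurable_norm])
    then have "(\<lambda>x. norm (g x) powr enn2real p) \<in> borel_measurable M" by measurable
    moreover have int: "integrable M (\<lambda>x. norm (f x) powr enn2real p)"
      using f that by (simp add: Lp_maps_def)
    moreover have "AE x in M. norm (f x) powr enn2real p = norm (g x) powr enn2real p"
      using eq by eventually_elim simp
    ultimately show ?thesis using integrable_cong_AE_imp by blast
  qed
  then show ?thesis using g bdd by (simp add: Lp_maps_def)
qed

section \<open>The precise representative\<close>

lemma precise_rep_has_limit:
  assumes "von_neumann_lifting M l" and "lebesgue_point M l E V x"
  shows "has_basis_limit M l x (class_average M V) (precise_rep M l E V x)"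
    and "precise_rep M l E V x \<in> E x"
proof -
  from assms(2) obtain z where z: "has_basis_limit M l x (class_average M V) z" "z \<in> E x"
    unfolding lebesgue_point_def by blast
  \<comment> \<open>Uniqueness of basis limits makes the definite description pick \<open>z\<close>,
    the limit that lies in the fibre.\<close>
  have "precise_rep M l E V x = z"
    unfolding precise_rep_def if_P[OF assms(2)]
    using z(1) has_basis_limit_unique[OF assms(1) _ z(1)] by (rule the_equality)
  with z show "has_basis_limit M l x (class_average M V) (precise_rep M l E V x)"
    and "precise_rep M l E V x \<in> E x" by auto
qed

theorem theorem3p5:
  fixes M :: "'a measure"
    and l :: "'a set \<Rightarrow> 'a set"
    and E :: "'a \<Rightarrow> 'b::banach set"
    and p :: ennreal
    and V :: "('a \<Rightarrow> 'b) set"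
  assumes "complete_measure M"
    and "sigma_finite_measure M"
    and "von_neumann_lifting M l"
    and "banach_bundle M E"
    and "1 \<le> p"
    and "V \<in> section_classes M p E"
  shows "(AE x\<in>basis_domain M l in M. lebesgue_point M l E V x) \<and>
    precise_rep M l E V \<in> section_maps M p E \<and>
    Lp_class M p (precise_rep M l E V) = V"
proof -
  note l = assms(3) and p = assms(5)
  let ?r = "precise_rep M l E V"
  from assms(6) obtain v where v: "v \<in> Lp_maps M p" "\<And>x. x \<in> space M \<Longrightarrow> v x \<in> E x"
    and V: "V = Lp_class M p v"
    unfolding section_classes_def section_maps_def by auto
  \<comment> \<open>This is the representative used inside \<open>class_average\<close>. It may
    leave the fibres on a null set, so fibre membership is always taken from
    \<open>v\<close>.\<close>
  define w where "w = (SOME w. w \<in> V)"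
  have "v \<in> V" using v V by (simp add: Lp_class_def)
  then have "w \<in> V" unfolding w_def by (rule someI[of "\<lambda>w. w \<in> V"])
  then have w: "w \<in> Lp_maps M p" "AE x in M. w x = v x" by (auto simp: V Lp_class_def)
  have avg: "class_average M V = (\<lambda>I. (1 / measure M I) *\<^sub>R banach_integral M (\<lambda>y. indicator I y *\<^sub>R w y))"
    by (simp add: fun_eq_iff class_average_def w_def)
  have ae: "AE x in M. lebesgue_point M l E V x \<and> ?r x = v x"
    using lifting_differentiation[OF assms(2) l w(1) p, folded avg] w(2) AE_space
  proof eventually_elim
    fix x
    assume x: "x \<in> basis_domain M l \<and> has_basis_limit M l x (class_average M V) (w x)"
      "w x = v x" "x \<in> space M"
    then have leb: "lebesgue_point M l E V x"
      unfolding lebesgue_point_def using v(2) by metis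
    moreover have "?r x = v x"
      using has_basis_limit_unique[OF l precise_rep_has_limit(1)[OF l leb]] x by auto
    ultimately show "lebesgue_point M l E V x \<and> ?r x = v x" ..
  qed
  then have eq: "AE x in M. ?r x = v x" by eventually_elim simp
  \<comment> \<open>The bound is required everywhere, so the almost everywhere identity with
    \<open>v\<close> does not suffice. A bound for \<open>w\<close> passes to all averages, then to
    their limits at Lebesgue points, and the value elsewhere is 0.\<close>
  have bdd: "bounded (?r ` space M)" if "p = \<infinity>"
  proof -
    have "bounded (w ` space M)" using w(1) that by (simp add: Lp_maps_def)
    then obtain C where C: "0 < C" "\<And>x. x \<in> space M \<Longrightarrow> norm (w x) \<le> C"
      unfolding bounded_pos by auto
    have "norm (class_average M V J) \<le> C" if "J \<in> lifting_basis M l" for J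
    proof -
      have "AE x in M. x \<in> J \<longrightarrow> norm (w x - 0) \<le> C"
        using AE_space by eventually_elim (simp add: C)
      from banach_average_dist_le[OF w(1) p lifting_basisD[OF l that] _ this]
      show ?thesis using C(1) by (simp add: avg)
    qed
    then have "norm (?r x) \<le> C" if "lebesgue_point M l E V x" for x
      using has_basis_limit_norm_le[OF precise_rep_has_limit(1)[OF l that]]
      by (auto simp: basis_at_def)
    then have "norm (?r x) \<le> C" for x
      using C(1) by (cases "lebesgue_point M l E V x") (auto simp: precise_rep_def)
    then show ?thesis by (auto simp: bounded_iff)
  qed
  have "?r \<in> Lp_maps M p" by (rule Lp_maps_AE_eq[OF assms(1) v(1) eq bdd])
  moreover have "?r x \<in> E x" if "x \<in> space M" for x
  proof (cases "lebesgue_point M l E V x")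
    case True
    then show ?thesis by (rule precise_rep_has_limit(2)[OF l])
  next
    case False
    \<comment> \<open>The default value 0 lies in every fibre because fibres are linear
      subspaces.\<close>
    then show ?thesis
      using assms(4) that by (simp add: precise_rep_def banach_bundle_def subspace_0)
  qed
  moreover have "AE x\<in>basis_domain M l in M. lebesgue_point M l E V x"
    using ae by eventually_elim simp
  \<comment> \<open>A class depends on its representative only up to null sets, so \<open>?r\<close>
    and \<open>v\<close> generate the same class.\<close>
  moreover have "(AE x in M. u x = ?r x) \<longleftrightarrow> (AE x in M. u x = v x)" for u
    using eq by (intro eventually_subst) (auto elim: eventually_mono)
  ultimately show ?thesis by (simp add: section_maps_def V Lp_class_def)
qed

end
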